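(* In the disclosure game described in the context, a function $V:E\to\mathbb{R}$ is the sender's value function in some (truth-leaning) equilibrium if and only if it satisfies the following three conditions: (1) $V$ is non-decreasing with respect to the disclosure rule, i.e. $e\precsim e'$ implies $V(e)\le V(e')$; (2) $\xi(V^{-1}(x))=x$ for all $x\in \mathrm{Range}(V)$; (3) $\xi(L)\ge x$ for all $x\in\mathrm{Range}(V)$ and all lower contour sets $L$ in $V^{-1}(x)$. Moreover, there is at most one function $V:E\to\mathbb{R}$ satisfying conditions (1)–(3).
   Context: Disclosure game. A state $\omega\in\{G,B\}$ is drawn with prior probability $\pi_0\in(0,1)$ on $G$. The evidence space $E$ is a finite or countably infinite set; $F_G,F_B$ are probability distributions on $E$ such that for every $e\in E$ at least one of $F_G(e),F_B(e)$ is strictly positive. The sender privately observes evidence $e\in E$ drawn from $F_\omega$. A disclosure rule is a preorder $\precsim$ on $E$ (reflexive and transitive) satisfying: for every sequence $e_1\succsim e_2\succsim\cdots$ in $E$ there is $N\ge1$ with $e_N\precsim e_n$ for all $n\ge N$. The sender with evidence $e$ sends a message $m\in E$ with $m\precsim e$. The receiver observes $m$ and takes an action $a\in\mathbb{R}$. The receiver has payoff $u_R(a,\omega)$, and it is assumed that for every $\mu\in[0,1]$ the problem $\max_a \mu u_R(a,G)+(1-\mu)u_R(a,B)$ has a unique solution $\phi(\mu)$, with $\phi:[0,1]\to\mathbb{R}$ strictly increasing. The sender's payoff is $a$. Notation: $LC(e)=\{m:m\precsim e\}$, $UC(m)=\{e:m\precsim e\}$. A sender strategy is $\sigma:E\to\Delta(E)$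 with $\mathrm{supp}\,\sigma(\cdot|e)\subset LC(e)$; a receiver strategy is $\mathbf{a}:E\to\mathbb{R}$; a belief system is $\mu:E\to[0,1]$ ($\mu(m)$ = posterior probability of $G$ after message $m$). For nonempty $A\subset E$ let $\nu(A)=\frac{F_G(A)\pi_0}{F_G(A)\pi_0+F_B(A)(1-\pi_0)}$ and $\xi(A)=\phi(\nu(A))$; write $\nu(e),\xi(e)$ for singletons. A (truth-leaning) equilibrium is a triple $(\sigma^\star,\mathbf{a}^\star,\mu)$ such that: (i) $\mathrm{supp}\,\sigma^\star(\cdot|e)\subset\arg\max_{m\precsim e}\mathbf{a}^\star(m)$ for all $e$; (ii) $\mathbf{a}^\star=\phi\circ\mu$; (iii) for every on-path message $m$ (i.e. $m\in\mathrm{supp}\,\sigma^\star(\cdot|e)$ for some $e$), $\mu(m)=\frac{\sum_{e\in UC(m)}\sigma^\star(m|e)F_G(e)\pi_0}{\sum_{e\in UC(m)}\sigma^\star(m|e)[F_G(e)\pi_0+F_B(e)(1-\pi_0)]}$; (iv) if $e\in\arg\max_{m\precsim e}\mathbf{a}^\star(m)$ then $\sigma^\star(e|e)=1$; (v) for every off-path message $m$, $\mu(m)=\nu(m)$. The sender's value function in an equilibrium is $V(e)=\max_{m\precsim e}\mathbf{a}^\star(m)$. $\mathrm{Range}(V)$ is the image of $V$ and $V^{-1}(x)=\{e\in E:V(e)=x\}$. For nonempty $A\subset E$, a nonempty $L\subset A$ is a lower contour set in $A$ if for all $e\in L$ and $e'\in A$, $e'\precsim e$ implies $e'\in L$. 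*)

theory Defs
  imports "HOL-Probability.Probability_Mass_Function"
begin

datatype state = G | B

definition disclosure_rule :: "('e \<Rightarrow> 'e \<Rightarrow> bool) \<Rightarrow> bool" where
  "disclosure_rule le \<longleftrightarrow> reflp le \<and> transp le \<and>
     (\<forall>s :: nat \<Rightarrow> 'e. (\<forall>n. le (s (Suc n)) (s n)) \<longrightarrow>
        (\<exists>N. \<forall>n\<ge>N. le (s N) (s n)))"

definition LC :: "('e \<Rightarrow> 'e \<Rightarrow> bool) \<Rightarrow> 'e \<Rightarrow> 'e set" where
  "LC le e = {m. le m e}"

definition UC :: "('e \<Rightarrow> 'e \<Rightarrow> bool) \<Rightarrow> 'e \<Rightarrow> 'e set" where
  "UC le m = {e. le m e}"

text \<open>Posterior nu(A) of G given evidence in A.\<close>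
definition nu :: "'e pmf \<Rightarrow> 'e pmf \<Rightarrow> real \<Rightarrow> 'e set \<Rightarrow> real" where
  "nu FG FB p0 A = measure_pmf.prob FG A * p0 /
     (measure_pmf.prob FG A * p0 + measure_pmf.prob FB A * (1 - p0))"

definition xi :: "(real \<Rightarrow> real) \<Rightarrow> 'e pmf \<Rightarrow> 'e pmf \<Rightarrow> real \<Rightarrow> 'e set \<Rightarrow> real" where
  "xi phi FG FB p0 A = phi (nu FG FB p0 A)"

definition lower_contour :: "('e \<Rightarrow> 'e \<Rightarrow> bool) \<Rightarrow> 'e set \<Rightarrow> 'e set \<Rightarrow> bool" where
  "lower_contour le L A \<longleftrightarrow> L \<noteq> {} \<and> L \<subseteq> A \<and>
     (\<forall>e\<in>L. \<forall>e'\<in>A. le e' e \<longrightarrow> e' \<in> L)"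

definition argmax_LC :: "('e \<Rightarrow> 'e \<Rightarrow> bool) \<Rightarrow> ('e \<Rightarrow> real) \<Rightarrow> 'e \<Rightarrow> 'e set" where
  "argmax_LC le a e = {m. le m e \<and> (\<forall>m'. le m' e \<longrightarrow> a m' \<le> a m)}"

definition on_path :: "('e \<Rightarrow> 'e pmf) \<Rightarrow> 'e \<Rightarrow> bool" where
  "on_path \<sigma> m \<longleftrightarrow> (\<exists>e. m \<in> set_pmf (\<sigma> e))"

definition equilibrium ::
  "('e \<Rightarrow> 'e \<Rightarrow> bool) \<Rightarrow> 'e pmf \<Rightarrow> 'e pmf \<Rightarrow> real \<Rightarrow> (real \<Rightarrow> real) \<Rightarrow>
   ('e \<Rightarrow> 'e pmf) \<Rightarrow> ('e \<Rightarrow> real) \<Rightarrow> ('e \<Rightarrow> real) \<Rightarrow> bool" where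
  "equilibrium le FG FB p0 phi \<sigma> a \<mu> \<longleftrightarrow>
     (\<forall>e. set_pmf (\<sigma> e) \<subseteq> LC le e) \<and>
     (\<forall>m. 0 \<le> \<mu> m \<and> \<mu> m \<le> 1) \<and>
     (\<forall>e. set_pmf (\<sigma> e) \<subseteq> argmax_LC le a e) \<and>
     (\<forall>m. a m = phi (\<mu> m)) \<and>
     (\<forall>m. on_path \<sigma> m \<longrightarrow>
        \<mu> m = (\<Sum>\<^sub>\<infinity>e\<in>UC le m. pmf (\<sigma> e) m * pmf FG e * p0) /
               (\<Sum>\<^sub>\<infinity>e\<in>UC le m. pmf (\<sigma> e) m * (pmf FG e * p0 + pmf FB e * (1 - p0)))) \<and>
     (\<forall>e. e \<in> argmax_LC le a e \<longrightarrow> pmf (\<sigma> e) e = 1) \<and>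
     (\<forall>m. \<not> on_path \<sigma> m \<longrightarrow> \<mu> m = nu FG FB p0 {m})"

definition is_max_value :: "('e \<Rightarrow> 'e \<Rightarrow> bool) \<Rightarrow> ('e \<Rightarrow> real) \<Rightarrow> ('e \<Rightarrow> real) \<Rightarrow> bool" where
  "is_max_value le a V \<longleftrightarrow>
     (\<forall>e. (\<exists>m. le m e \<and> a m = V e) \<and> (\<forall>m. le m e \<longrightarrow> a m \<le> V e))"

definition equilibrium_value ::
  "('e \<Rightarrow> 'e \<Rightarrow> bool) \<Rightarrow> 'e pmf \<Rightarrow> 'e pmf \<Rightarrow> real \<Rightarrow> (real \<Rightarrow> real) \<Rightarrow> ('e \<Rightarrow> real) \<Rightarrow> bool" where
  "equilibrium_value le FG FB p0 phi V \<longleftrightarrow>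
     (\<exists>\<sigma> a \<mu>. equilibrium le FG FB p0 phi \<sigma> a \<mu> \<and> is_max_value le a V)"

definition conditions ::
  "('e \<Rightarrow> 'e \<Rightarrow> bool) \<Rightarrow> 'e pmf \<Rightarrow> 'e pmf \<Rightarrow> real \<Rightarrow> (real \<Rightarrow> real) \<Rightarrow> ('e \<Rightarrow> real) \<Rightarrow> bool" where
  "conditions le FG FB p0 phi V \<longleftrightarrow>
     (\<forall>e e'. le e e' \<longrightarrow> V e \<le> V e') \<and>
     (\<forall>x\<in>range V. xi phi FG FB p0 (V -` {x}) = x) \<and>
     (\<forall>x\<in>range V. \<forall>L. lower_contour le L (V -` {x}) \<longrightarrow> xi phi FG FB p0 L \<ge> x)"

end

theory Submission
  imports Defs
begin

text \<open>
  Write \<open>V = phi \<circ> q\<close> with \<open>q\<close> a posterior and give evidence \<open>e\<close> the signed weight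
  \<open>excess q e = g e - q e * w e\<close>. The conditions say that \<open>q\<close> is monotone, that the excess sums to zero on
  each fibre of \<open>q\<close>, and that it has nonnegative sum on each lower contour set of a fibre.

  In an equilibrium the types sending a given message have total excess zero. For a lower contour set
  \<open>L\<close> of a fibre, all types in \<open>L\<close> send messages in \<open>L\<close>, and types outside \<open>L\<close> sending messages in \<open>L\<close>
  do not disclose and hence have negative excess; so the sum over \<open>L\<close> is nonnegative.

  Conversely, types with nonnegative excess disclose, and the others must mix over disclosing types
  below them in the same fibre so that the excess of each message cancels. This is a transportation
  problem between negative and positive parts of the excess. The lower contour condition is exactly
  Hall's condition, so Strassen's theorem for discrete distributions provides the mixing.

  For uniqueness, sum over \<open>D = {e. q' e < q e}\<close>: the sum of \<open>excess q\<close> is nonnegative, that of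
  \<open>excess q'\<close> is nonpositive, yet \<open>excess q < excess q'\<close> on \<open>D\<close>.
\<close>

section \<open>Sums and discrete distributions\<close>

lemma summable_on_abs_le:
  fixes f h :: "'a \<Rightarrow> real"
  assumes "h summable_on A" "\<And>x. x \<in> A \<Longrightarrow> \<bar>f x\<bar> \<le> h x"
  shows "f summable_on A"
proof -
  have "(\<lambda>x. norm (h x)) summable_on A"
    using assms(1) summable_on_iff_abs_summable_on_real by blast
  then have "(\<lambda>x. norm (f x)) summable_on A"
    by (rule Infinite_Sum.abs_summable_on_comparison_test) (use assms(2) in force)
  then show ?thesis by (rule abs_summable_summable)
qed

lemma
  fixes f h :: "'a \<Rightarrow> real"
  assumes "f summable_on A" "h summable_on A"
  shows summable_on_diff_real: "(\<lambda>x. f x - h x) summable_on A"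
    and infsum_diff_real: "infsum (\<lambda>x. f x - h x) A = infsum f A - infsum h A"
  using summable_on_add[of f A "\<lambda>x. - h x"] infsum_add[of f A "\<lambda>x. - h x"] assms
  by (simp_all add: summable_on_uminus infsum_uminus)

lemma infsum_pmf: "infsum (pmf p) A = measure_pmf.prob p A"
  by (metis measure_pmf_conv_infsetsum abs_summable_equivalent infsetsum_infsum pmf_abs_summable)

lemma pmf_summable_on: "pmf p summable_on A"
  by (metis abs_summable_equivalent abs_summable_summable pmf_abs_summable)

lemma pmf_embed_infsum:
  fixes t :: "'x \<Rightarrow> real"
  assumes "\<And>x. 0 \<le> t x" and "t summable_on UNIV" and "infsum t UNIV = 1"
  shows "\<exists>r. \<forall>x. pmf r x = t x"
proof -
  have a: "Infinite_Set_Sum.abs_summable_on t UNIV"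
    using assms(2) summable_on_iff_abs_summable_on_real abs_summable_equivalent by blast
  have "(\<integral>\<^sup>+x. ennreal (t x) \<partial>count_space UNIV) = 1"
    using nn_integral_conv_infsetsum[OF a] assms a abs_summable_equivalent[of t UNIV]
    by (simp add: infsetsum_infsum)
  then have "\<forall>x. pmf (embed_pmf t) x = t x"
    by (simp add: pmf_embed_pmf assms(1))
  then show ?thesis by blast
qed

text \<open>Zorn works here because every constraint only concerns finite partial sums, so pointwise
suprema of chains remain feasible.\<close>

lemma maximal_packing:
  fixes \<C> :: "('x set \<times> real) set"
  assumes nonneg: "\<forall>(X, c)\<in>\<C>. 0 \<le> c" and top: "(UNIV, C) \<in> \<C>"
  shows "\<exists>t. (\<forall>x. 0 \<le> t x) \<and> t summable_on UNIV \<and> (\<forall>(X, c)\<in>\<C>. infsum t X \<le> c) \<and>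
    (\<forall>x d. 0 < d \<longrightarrow> (\<exists>(X, c)\<in>\<C>. x \<in> X \<and> c < infsum t X + d))"
proof -
  define K where "K = {t :: 'x \<Rightarrow> real. (\<forall>x. 0 \<le> t x) \<and>
    (\<forall>(X, c)\<in>\<C>. \<forall>F. finite F \<and> F \<subseteq> X \<longrightarrow> sum t F \<le> c)}"
  have KI: "t \<in> K" if "\<And>x. 0 \<le> t x"
    "\<And>X c F. (X, c) \<in> \<C> \<Longrightarrow> finite F \<Longrightarrow> F \<subseteq> X \<Longrightarrow> sum t F \<le> c" for t
    using that by (auto simp: K_def)
  have K0: "0 \<le> t x" if "t \<in> K" for t x using that by (auto simp: K_def)
  have KC: "sum t F \<le> c" if "t \<in> K" "(X, c) \<in> \<C>" "finite F" "F \<subseteq> X" for t X c F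
    using that by (auto simp: K_def)
  have KC1: "t x \<le> C" if "t \<in> K" for t x
    using KC[OF that top, of "{x}"] by simp
  have "partial_order_on K (relation_of (\<le>) K)"
    by (rule partial_order_on_relation_ofI) auto
  moreover have "\<exists>u\<in>K. \<forall>a\<in>Ch. a \<le> u" if Ch: "Ch \<in> Chains (relation_of (\<le>) K)" for Ch
  proof (cases "Ch = {}")
    case True
    moreover have "(\<lambda>_. 0) \<in> K"
      using nonneg by (intro KI) auto
    ultimately show ?thesis by blast
  next
    case False
    have ChK: "Ch \<subseteq> K" and tot: "\<And>a b. a \<in> Ch \<Longrightarrow> b \<in> Ch \<Longrightarrow> a \<le> b \<or> b \<le> a"
      using Ch by (auto simp: Chains_def relation_of_def)
    define u where "u x = (SUP a\<in>Ch. a x)" for x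
    have bdd: "bdd_above ((\<lambda>a. a x) ` Ch)" for x
      using ChK KC1 by (intro bdd_aboveI2[where M = C]) auto
    have upper: "a x \<le> u x" if "a \<in> Ch" for a x
      unfolding u_def by (rule cSUP_upper[OF that bdd])
    \<comment> \<open>The chain is totally ordered, so the members that approximate \<open>u\<close>
      at the finitely many points of \<open>F\<close> have a largest one, which works at all of
      them.\<close>
    have approx: "\<exists>a\<in>Ch. \<forall>x\<in>F. u x \<le> a x + d" if "finite F" "0 < d" for F d
      using that
    proof (induction F)
      case empty
      then show ?case using False by auto
    next
      case (insert y F)
      then obtain a where a: "a \<in> Ch" "\<And>x. x \<in> F \<Longrightarrow> u x \<le> a x + d" by auto
      have "\<exists>b\<in>Ch. u y - d < b y"
        using less_cSUP_iff[OF False bdd, of "u y - d" y] insert.prems by (simp add: u_def)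
      then obtain b where b: "b \<in> Ch" "u y \<le> b y + d" by force
      from tot[OF a(1) b(1)] show ?case
      proof
        assume "a \<le> b"
        then have "\<forall>x\<in>insert y F. u x \<le> b x + d"
          using a b by (fastforce simp: le_fun_def intro: order_trans)
        then show ?thesis using b by blast
      next
        assume "b \<le> a"
        then have "u y \<le> a y + d" using b(2) by (smt (verit) le_fun_def)
        then show ?thesis using a by blast
      qed
    qed
    have "u \<in> K"
    proof (rule KI)
      fix x
      obtain a where "a \<in> Ch" using False by blast
      then show "0 \<le> u x" using upper[of a x] K0[of a x] ChK by auto
    next
      fix X c F assume XF: "(X, c) \<in> \<C>" "finite F" "F \<subseteq> X"
      show "sum u F \<le> c"
      proof (rule field_le_epsilon)
        fix d :: real assume "0 < d"
        \<comment> \<open>Dividing by the cardinality shares the error among the points of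
          \<open>F\<close>; the \<open>+ 1\<close> covers empty \<open>F\<close>.\<close>
        define d' where "d' = d / (card F + 1)"
        have "0 < d'" using \<open>0 < d\<close> by (simp add: d'_def)
        then obtain a where a: "a \<in> Ch" "\<And>x. x \<in> F \<Longrightarrow> u x \<le> a x + d'"
          using approx[OF XF(2)] by blast
        have "sum u F \<le> sum a F + card F * d'"
          using sum_mono[of F u "\<lambda>x. a x + d'"] a(2) by (simp add: sum.distrib)
        also have "sum a F \<le> c" using KC a(1) ChK XF by blast
        also have "card F * d' \<le> d"
          using \<open>0 < d\<close> by (simp add: d'_def field_simps)
        finally show "sum u F \<le> c + d" by simp
      qed
    qed
    then show ?thesis using upper by (auto simp: le_fun_def)
  qed
  ultimately obtain t where t: "t \<in> K" and max: "\<And>a. a \<in> K \<Longrightarrow> t \<le> a \<Longrightarrow> a = t"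
    using predicate_Zorn[of K "(\<le>)"] by blast
  have "t summable_on UNIV"
    using KC[OF t top] K0[OF t] by (intro nonneg_bdd_above_summable_on bdd_aboveI2[where M = C]) auto
  then have summ: "t summable_on X" for X
    using summable_on_subset_banach by blast
  show ?thesis
  proof (intro exI[of _ t] conjI allI impI)
    show "0 \<le> t x" for x by (rule K0[OF t])
    show "t summable_on UNIV" by fact
    have "infsum t X \<le> c" if "(X, c) \<in> \<C>" for X c
      using KC[OF t that] by (intro infsum_le_finite_sums summ)
    then show "\<forall>(X, c)\<in>\<C>. infsum t X \<le> c" by blast
    show "\<exists>(X, c)\<in>\<C>. x \<in> X \<and> c < infsum t X + d" if "0 < d" for x d
    proof -
      \<comment> \<open>Raising \<open>t\<close> at \<open>x\<close> contradicts maximality, so it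
        breaks some finite constraint. That constraint must involve \<open>x\<close>, and before the
        change it was slack by less than \<open>d\<close>.\<close>
      have "t(x := t x + d) \<notin> K"
      proof
        assume "t(x := t x + d) \<in> K"
        moreover have "t \<le> t(x := t x + d)" using that by (simp add: le_fun_def)
        ultimately have "(t(x := t x + d)) x = t x" using max by metis
        then show False using that by simp
      qed
      moreover have "0 \<le> (t(x := t x + d)) z" for z
        using K0[OF t] that by simp
      ultimately obtain X c F where XF: "(X, c) \<in> \<C>" "finite F" "F \<subseteq> X"
        and c: "c < sum (t(x := t x + d)) F"
        using KI[of "t(x := t x + d)"] by (meson not_le)
      have "x \<in> F"
      proof (rule ccontr)
        assume "x \<notin> F"
        then have "sum (t(x := t x + d)) F = sum t F" by (intro sum.cong) auto
        then show False using KC[OF t XF] c by simp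
      qed
      then have "sum (t(x := t x + d)) F = sum t F + d"
        using XF(2) by (simp add: sum.remove)
      moreover have "sum t F \<le> infsum t X"
        using XF K0[OF t] by (intro finite_sum_le_infsum summ) auto
      ultimately have "x \<in> X \<and> c < infsum t X + d"
        using XF(3) \<open>x \<in> F\<close> c by auto
      then show ?thesis using XF(1) by blast
    qed
  qed
qed

section \<open>Strassen's theorem for discrete distributions\<close>

text \<open>Strassen's theorem, the converse of \<open>rel_pmf_measureD\<close>. The candidate coupling \<open>t\<close> is a maximal
packing for the constraints \<open>t ((- S) \<times> T) \<le> q T - p S\<close>, one for each \<open>S\<close> and each \<open>T\<close> containing
all partners of \<open>S\<close>. The slack of these constraints is subadditive under joint unions. Hence if \<open>x\<close>
kept unallocated mass, combining nearly tight constraints that block the pairs \<open>(x, y)\<close> would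
violate the constraint of some \<open>S\<close> enlarged by \<open>x\<close>.\<close>

theorem rel_pmf_measureI:
  fixes p :: "'a pmf" and q :: "'b pmf"
  assumes hall: "\<And>S. measure_pmf.prob p S \<le> measure_pmf.prob q {y. \<exists>x\<in>S. R x y}"
  shows "rel_pmf R p q"
proof -
  define N where "N S = {y. \<exists>x\<in>S. R x y}" for S
  let ?P = "measure_pmf.prob p" and ?Q = "measure_pmf.prob q"
  \<comment> \<open>The zero caps confine \<open>t\<close> to \<open>R\<close>. In a coupling
    supported on \<open>R\<close> the whole mass of \<open>S\<close> lands in \<open>T\<close>,
    which leaves \<open>?Q T - ?P S\<close> for the rows outside \<open>S\<close>.\<close>
  define \<C> where "\<C> = {({(x, y)}, 0) |x y. \<not> R x y} \<union> {((- S) \<times> T, ?Q T - ?P S) |S T. N S \<subseteq> T}"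
  have cap_nonneg: "?P S \<le> ?Q T" if "N S \<subseteq> T" for S T
    using hall[of S] measure_pmf.finite_measure_mono[OF that, of q] by (simp add: N_def)
  then have caps: "\<forall>(X, c)\<in>\<C>. 0 \<le> c"
    by (auto simp: \<C>_def)
  have top: "(UNIV, 1) \<in> \<C>"
  proof -
    have "((- {}) \<times> UNIV, ?Q UNIV - ?P {}) \<in> \<C>" unfolding \<C>_def N_def by blast
    then show ?thesis by simp
  qed
  obtain t where t0: "\<And>z. 0 \<le> t z" and "t summable_on UNIV"
    and packing: "\<And>X c. (X, c) \<in> \<C> \<Longrightarrow> infsum t X \<le> c"
    and tight: "\<And>z d. 0 < d \<Longrightarrow> \<exists>(X, c)\<in>\<C>. z \<in> X \<and> c < infsum t X + d"
    using maximal_packing[OF caps top] by blast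
  then have summ: "t summable_on X" for X
    using summable_on_subset_banach by blast
  have tR: "t (x, y) = 0" if "\<not> R x y" for x y
    using packing[of "{(x, y)}" 0] that t0[of "(x, y)"] by (simp add: \<C>_def)
  have mono: "infsum t X \<le> infsum t Y" if "\<And>x y. (x, y) \<in> X \<Longrightarrow> R x y \<Longrightarrow> (x, y) \<in> Y" for X Y
  proof (intro infsum_mono_neutral summ)
    show "t z \<le> 0" if "z \<in> X - Y" for z
      using that \<open>\<And>x y. (x, y) \<in> X \<Longrightarrow> R x y \<Longrightarrow> (x, y) \<in> Y\<close> tR by (cases z) force
  qed (use t0 in auto)
  have cut: "infsum t ((- S) \<times> T) \<le> ?Q T - ?P S" if "N S \<subseteq> T" for S T
    using that by (intro packing) (auto simp: \<C>_def)
  \<comment> \<open>A pair in \<open>R\<close> has no zero cap, so the nearly tight constraint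
    through it must be a cut.\<close>
  have block: "\<exists>S T. N S \<subseteq> T \<and> x \<notin> S \<and> y \<in> T \<and> ?Q T - ?P S < infsum t ((- S) \<times> T) + d"
    if "R x y" "0 < d" for x y d
    using tight[OF that(2), of "(x, y)"] that(1) by (auto simp: \<C>_def)
  define slack where "slack S T = ?Q T - ?P S - infsum t ((- S) \<times> T)" for S T
  have modular: "measure_pmf.prob m (A \<union> B) + measure_pmf.prob m (A \<inter> B)
      = measure_pmf.prob m A + measure_pmf.prob m B" for m :: "'z pmf" and A B
    using measure_pmf.finite_measure_Union'[of A m B] measure_pmf.finite_measure_Diff'[of B m A]
    by (simp add: Int_commute)
  \<comment> \<open>Submodularity: on \<open>R\<close>, the rectangles \<open>?U\<close> and
    \<open>?I\<close> cover each pair at least as often as \<open>?X\<close> and \<open>?Y\<close>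
    do. If \<open>x\<close> lies outside \<open>S\<close> but in \<open>S'\<close>, its partners lie
    in \<open>T'\<close>, which puts the pair into \<open>?I\<close>. The slack belonging to
    \<open>?I\<close> is nonnegative and is dropped.\<close>
  have uncross: "slack (S \<union> S') (T \<union> T') \<le> slack S T + slack S' T'"
    if N: "N S \<subseteq> T" "N S' \<subseteq> T'" for S S' T T'
  proof -
    let ?X = "(- S) \<times> T" and ?Y = "(- S') \<times> T'"
    let ?U = "(- (S \<union> S')) \<times> (T \<union> T')" and ?I = "(- (S \<inter> S')) \<times> (T \<inter> T')"
    have "infsum t (?X \<union> ?Y) \<le> infsum t (?U \<union> ?I)"
      by (rule mono) (use N in \<open>auto simp: N_def\<close>)
    moreover have "infsum t (?X \<inter> ?Y) \<le> infsum t (?U \<inter> ?I)"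
      by (rule mono) auto
    ultimately have "infsum t ?X + infsum t ?Y \<le> infsum t ?U + infsum t ?I"
      using infsum_Un_Int[OF summ summ summ, of ?X ?Y] infsum_Un_Int[OF summ summ summ, of ?U ?I]
      by linarith
    moreover have "infsum t ?I \<le> ?Q (T \<inter> T') - ?P (S \<inter> S')"
      using N by (intro cut) (auto simp: N_def)
    ultimately show ?thesis
      using modular[of p S S'] modular[of q T T'] unfolding slack_def by linarith
  qed
  \<comment> \<open>Joining one blocking cut per partner of \<open>x\<close> in \<open>F\<close>
    puts all these partners into \<open>T\<close>, while \<open>x\<close> stays outside
    \<open>S\<close> and the slacks add up.\<close>
  have avoid: "\<exists>S T. N S \<subseteq> T \<and> x \<notin> S \<and> N {x} \<inter> F \<subseteq> T \<and> slack S T \<le> real (card F) * d"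
    if "finite F" "0 < d" for F x and d :: real
    using that
  proof (induction F)
    case empty
    have "N {} \<subseteq> {} \<and> x \<notin> {} \<and> N {x} \<inter> {} \<subseteq> {} \<and> slack {} {} \<le> real (card {}) * d"
      by (simp add: N_def slack_def)
    then show ?case by blast
  next
    case (insert y F)
    then obtain S T where ST: "N S \<subseteq> T" "x \<notin> S" "N {x} \<inter> F \<subseteq> T" "slack S T \<le> real (card F) * d"
      by blast
    show ?case
    proof (cases "R x y")
      case True
      then obtain S' T' where ST': "N S' \<subseteq> T'" "x \<notin> S'" "y \<in> T'" "slack S' T' < d"
        using block[of x y d] insert.prems by (force simp: slack_def)
      have "slack (S \<union> S') (T \<union> T') \<le> real (card (insert y F)) * d"
        using uncross[OF ST(1) ST'(1)] ST(4) ST'(4) insert.hyps by (simp add: algebra_simps)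
      moreover have "N (S \<union> S') \<subseteq> T \<union> T'"
        using ST(1) ST'(1) by (auto simp: N_def)
      ultimately show ?thesis
        using ST ST' by (intro exI[of _ "S \<union> S'"] exI[of _ "T \<union> T'"]) auto
    next
      case False
      then have "N {x} \<inter> insert y F \<subseteq> T" using ST(3) by (auto simp: N_def)
      moreover have "real (card F) * d \<le> real (card (insert y F)) * d"
        using insert by (intro mult_right_mono) auto
      ultimately show ?thesis
        using ST by (intro exI[of _ S] exI[of _ T]) (auto intro: order_trans)
    qed
  qed
  have row_ge: "pmf p x \<le> infsum t ({x} \<times> UNIV)" for x
  proof (rule field_le_epsilon)
    fix e :: real assume "0 < e"
    \<comment> \<open>\<open>F\<close> carries all but \<open>e / 2\<close> of \<open>q\<close>, and
      \<open>d\<close> keeps the joined slack below \<open>e / 2\<close>. Enlarging \<open>S\<close>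
      by \<open>x\<close> and \<open>T\<close> by the partners of \<open>x\<close> then adds to
      \<open>T\<close> only points outside \<open>F\<close>.\<close>
    obtain F where F: "finite F" "1 - e / 2 \<le> ?Q F"
      using infsum_finite_approximation[OF pmf_summable_on[of q UNIV], of "e / 2"] \<open>0 < e\<close>
      by (force simp: infsum_pmf dist_real_def measure_measure_pmf_finite)
    define d where "d = e / (2 * (card F + 1))"
    have "0 < d" using \<open>0 < e\<close> by (simp add: d_def)
    then obtain S T where ST: "N S \<subseteq> T" "x \<notin> S" "N {x} \<inter> F \<subseteq> T" "slack S T \<le> real (card F) * d"
      using avoid[OF F(1), of d x] by blast
    have "real (card F) * d \<le> e / 2"
      using \<open>0 < e\<close> by (simp add: d_def field_simps)
    let ?T = "T \<union> N {x}"
    have "infsum t ((- insert x S) \<times> ?T) \<le> ?Q ?T - ?P (insert x S)"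
      using ST(1) by (intro cut) (auto simp: N_def)
    moreover have "?P (insert x S) = ?P S + pmf p x"
      using ST(2) measure_pmf.finite_measure_Union[of "{x}" p S] by (simp add: measure_pmf_single)
    moreover have "?Q ?T \<le> ?Q T + ?Q (- F)"
    proof -
      have "?Q ?T \<le> ?Q (T \<union> - F)"
        using ST(3) by (intro measure_pmf.finite_measure_mono) auto
      then show ?thesis
        using modular[of q T "- F"] measure_nonneg[of q "T \<inter> - F"] by linarith
    qed
    moreover have "?Q (- F) \<le> e / 2"
      using F(2) measure_pmf.prob_compl[of F q] by (simp add: Compl_eq_Diff_UNIV)
    moreover have "infsum t ((- S) \<times> T) \<le> infsum t ({x} \<times> UNIV \<union> (- insert x S) \<times> ?T)"
      by (rule mono) auto
    moreover have "\<dots> = infsum t ({x} \<times> UNIV) + infsum t ((- insert x S) \<times> ?T)"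
      by (rule infsum_Un_disjoint[OF summ summ]) auto
    ultimately show "pmf p x \<le> infsum t ({x} \<times> UNIV) + e"
      using ST(4) \<open>real (card F) * d \<le> e / 2\<close> by (simp add: slack_def)
  qed
  \<comment> \<open>The reverse inequality is the cut for all rows except \<open>x\<close>.\<close>
  have row: "infsum t ({x} \<times> UNIV) = pmf p x" for x
    using row_ge[of x] cut[of "- {x}" UNIV] measure_pmf.prob_compl[of "{x}" p]
    by (simp add: measure_pmf_single flip: Compl_eq_Diff_UNIV)
  have col: "infsum t (UNIV \<times> {y}) \<le> pmf q y" for y
    using cut[of "{}" "{y}"] by (simp add: measure_pmf_single N_def)
  have "infsum (\<lambda>y. t (x, y)) UNIV = pmf p x" for x
  proof -
    have "{x} \<times> (UNIV :: 'b set) = range (Pair x)" by auto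
    then show ?thesis
      using row[of x] infsum_reindex[of "Pair x" UNIV t] by (simp add: o_def inj_on_def)
  qed
  then have "infsum t UNIV = 1"
    using infsum_Sigma_banach[of t UNIV "\<lambda>_. UNIV"] summ by (simp add: infsum_pmf)
  then obtain r where r: "\<And>z. pmf r z = t z"
    using pmf_embed_infsum[of t] t0 summ by blast
  then have rt: "measure_pmf.prob r X = infsum t X" for X
    using infsum_pmf[of r X] by (metis infsum_cong)
  have "map_pmf fst r = p"
    by (rule pmf_eqI) (simp add: pmf_map rt row[symmetric] vimage_fst)
  moreover have "map_pmf snd r = q"
  \<comment> \<open>The columns are only bounded by \<open>q\<close>. As both sides have total mass
    one, distinct distributions would force a column above its bound.\<close>
  proof (rule ccontr)
    assume "map_pmf snd r \<noteq> q"
    then obtain y where "pmf q y < pmf (map_pmf snd r) y"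
      using pmf_neq_exists_less by metis
    then show False using col[of y] by (simp add: pmf_map rt vimage_snd)
  qed
  moreover have "R x y" if "(x, y) \<in> set_pmf r" for x y
    using that tR[of x y] r[of "(x, y)"] by (auto simp: set_pmf_iff)
  ultimately show ?thesis
    by (auto simp: rel_pmf.simps)
qed

section \<open>Fibrewise sums and transport kernels\<close>

text \<open>Summability lets the sum over \<open>D\<close> be regrouped into a sum of fibre sums,
  even with infinitely many fibres.\<close>

lemma infsum_fibres_nonneg:
  fixes f :: "'a \<Rightarrow> real" and k :: "'a \<Rightarrow> 'b"
  assumes "f summable_on D" and fibre: "\<And>x. 0 \<le> infsum f (D \<inter> k -` {x})"
  shows "0 \<le> infsum f D"
proof -
  let ?S = "Sigma (k ` D) (\<lambda>x. D \<inter> k -` {x})"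
  have inj: "inj_on snd ?S" by (auto simp: inj_on_def)
  have img: "snd ` ?S = D" by (auto simp: image_iff)
  have "f \<circ> snd summable_on ?S"
    using summable_on_reindex[OF inj, of f] assms(1) img by simp
  then have "infsum f D = infsum (\<lambda>x. infsum f (D \<inter> k -` {x})) (k ` D)"
    using infsum_reindex[OF inj, of f] img infsum_Sigma_banach[of "f \<circ> snd" "k ` D" "\<lambda>x. D \<inter> k -` {x}"]
    by (simp add: o_def)
  then show ?thesis
    by (simp add: infsum_nonneg fibre)
qed

lemma infsum_pmf_slices:
  fixes r :: "('a \<times> 'b) pmf"
  shows "infsum (\<lambda>y. pmf r (x, y)) UNIV = pmf (map_pmf fst r) x"
    and "infsum (\<lambda>x. pmf r (x, y)) UNIV = pmf (map_pmf snd r) y"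
proof -
  have "range (Pair x) = (fst -` {x} :: ('a \<times> 'b) set)"
    "range (\<lambda>x. (x, y)) = (snd -` {y} :: ('a \<times> 'b) set)" by auto
  then show "infsum (\<lambda>y. pmf r (x, y)) UNIV = pmf (map_pmf fst r) x"
    "infsum (\<lambda>x. pmf r (x, y)) UNIV = pmf (map_pmf snd r) y"
    using infsum_reindex[of "Pair x" UNIV "pmf r"] infsum_reindex[of "\<lambda>x. (x, y)" UNIV "pmf r"]
    by (simp_all add: pmf_map infsum_pmf o_def inj_on_def)
qed

text \<open>After division by the common total, Strassen's theorem couples the two distributions;
  conditioning the coupling on its first coordinate gives the kernel. Where \<open>d x = 0\<close>,
  the value of \<open>\<kappa> x\<close> is arbitrary and carries no weight.\<close>

lemma transport_kernel:
  fixes d :: "'a \<Rightarrow> real" and s :: "'b \<Rightarrow> real"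
  assumes d0: "\<And>x. 0 \<le> d x" and d: "d summable_on UNIV"
    and s0: "\<And>y. 0 \<le> s y" and s: "s summable_on UNIV"
    and total: "infsum d UNIV = infsum s UNIV"
    and hall: "\<And>S. infsum d S \<le> infsum s {y. \<exists>x\<in>S. R x y}"
  shows "\<exists>\<kappa> :: 'a \<Rightarrow> 'b pmf.
    (\<forall>x y. 0 < d x \<longrightarrow> y \<in> set_pmf (\<kappa> x) \<longrightarrow> R x y \<and> 0 < s y) \<and>
    (\<forall>y. infsum (\<lambda>x. d x * pmf (\<kappa> x) y) UNIV = s y)"
proof (cases "infsum d UNIV = 0")
  case True
  have "d x = 0" for x
    using finite_sum_le_infsum[OF d, of "{x}"] True d0 by (simp add: order_antisym)
  moreover have "s y = 0" for y
    using finite_sum_le_infsum[OF s, of "{y}"] True total s0 by (simp add: order_antisym)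
  ultimately show ?thesis
    by (intro exI[of _ "\<lambda>_. return_pmf undefined"]) auto
next
  case False
  define c where "c = infsum d UNIV"
  have "0 < c"
    using False infsum_nonneg[of UNIV d] d0 by (simp add: c_def)
  have normalise: "\<exists>p. \<forall>x. pmf p x = t x / c"
    if "\<And>x. 0 \<le> t x" "t summable_on UNIV" "infsum t UNIV = c" for t :: "'z \<Rightarrow> real"
  proof -
    have "(\<lambda>x. t x * inverse c) summable_on UNIV" "infsum (\<lambda>x. t x * inverse c) UNIV = 1"
      using that \<open>0 < c\<close> by (simp_all add: summable_on_cmult_left infsum_cmult_left')
    then show ?thesis
      using pmf_embed_infsum[of "\<lambda>x. t x * inverse c"] that(1) \<open>0 < c\<close>
      by (simp add: divide_inverse)
  qed
  obtain p where p: "\<And>x. pmf p x = d x / c"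
    using normalise[OF d0 d] by (auto simp: c_def)
  obtain q where q: "\<And>y. pmf q y = s y / c"
    using normalise[OF s0 s] total by (auto simp: c_def)
  have pq: "measure_pmf.prob p A = infsum d A / c" "measure_pmf.prob q B = infsum s B / c" for A B
    using infsum_cmult_left'[of d "inverse c" A] infsum_cmult_left'[of s "inverse c" B]
    using ext[of "pmf p", OF p] ext[of "pmf q", OF q] by (simp_all add: divide_inverse flip: infsum_pmf)
  have "rel_pmf R p q"
    using hall \<open>0 < c\<close> by (intro rel_pmf_measureI) (simp add: pq divide_right_mono)
  then obtain r where r: "\<And>x y. (x, y) \<in> set_pmf r \<Longrightarrow> R x y"
    and fst: "map_pmf fst r = p" and snd: "map_pmf snd r = q"
    by (auto simp: rel_pmf.simps)
  define \<kappa> where "\<kappa> x = map_pmf snd (cond_pmf r (fst -` {x}))" for x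
  have cond: "set_pmf r \<inter> fst -` {x} \<noteq> {}" if "0 < d x" for x
  proof -
    have "x \<in> set_pmf (map_pmf fst r)"
      using that \<open>0 < c\<close> by (simp add: fst set_pmf_iff p)
    then show ?thesis by auto
  qed
  have mass: "d x * pmf (\<kappa> x) y = c * pmf r (x, y)" for x y
  proof (cases "0 < d x")
    case True
    have "pmf (\<kappa> x) y = measure_pmf.prob (cond_pmf r (fst -` {x})) (snd -` {y})"
      by (simp add: \<kappa>_def pmf_map)
    also have "\<dots> = measure_pmf.prob (cond_pmf r (fst -` {x})) {(x, y)}"
      by (rule measure_pmf.finite_measure_eq_AE)
        (auto simp: AE_measure_pmf_iff set_cond_pmf[OF cond[OF True]])
    also have "\<dots> = pmf r (x, y) / (d x / c)"
      using p[of x] by (simp add: measure_pmf_single pmf_cond[OF cond[OF True]] flip: fst pmf_map)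
    finally show ?thesis using True by simp
  next
    case False
    then have "d x = 0" using d0[of x] by simp
    moreover have "pmf r (x, y) = 0"
      using p[of x] \<open>d x = 0\<close> by (auto simp: pmf_eq_0_set_pmf simp flip: fst intro: rev_image_eqI)
    ultimately show ?thesis by simp
  qed
  show ?thesis
  proof (intro exI[of _ \<kappa>] conjI allI impI)
    fix x y assume x: "0 < d x" and "y \<in> set_pmf (\<kappa> x)"
    then have xy: "(x, y) \<in> set_pmf r"
      using set_cond_pmf[OF cond[OF x]] by (auto simp: \<kappa>_def)
    then have "y \<in> set_pmf q" by (force simp flip: snd)
    then have "s y \<noteq> 0" by (simp add: set_pmf_iff q)
    then show "0 < s y" using s0[of y] by simp
    show "R x y" by (rule r[OF xy])
  next
    show "infsum (\<lambda>x. d x * pmf (\<kappa> x) y) UNIV = s y" for y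
      using \<open>0 < c\<close> by (simp add: mass infsum_cmult_right' infsum_pmf_slices snd q)
  qed
qed

section \<open>The disclosure game\<close>

locale evidence_game =
  fixes le :: "'e \<Rightarrow> 'e \<Rightarrow> bool" and FG FB :: "'e pmf" and p0 :: real and phi :: "real \<Rightarrow> real"
  assumes p0_pos: "0 < p0" and p0_less: "p0 < 1"
    and full_support: "\<forall>e. pmf FG e > 0 \<or> pmf FB e > 0"
    and le_refl: "reflp le" and le_trans: "transp le"
    and phi_mono: "strict_mono_on {0..1} phi"
begin

text \<open>Joint weight of \<open>G\<close> and \<open>e\<close>, and total weight of \<open>e\<close>. Thus \<open>nu FG FB p0 A \<ge> c\<close> becomes the linear
condition that \<open>g - c * w\<close> has nonnegative sum over \<open>A\<close>.\<close>

definition g :: "'e \<Rightarrow> real" where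
  "g e = pmf FG e * p0"

definition w :: "'e \<Rightarrow> real" where
  "w e = pmf FG e * p0 + pmf FB e * (1 - p0)"

definition excess :: "('e \<Rightarrow> real) \<Rightarrow> 'e \<Rightarrow> real" where
  "excess q e = g e - q e * w e"

text \<open>The three conditions with \<open>phi\<close> stripped off: \<open>q\<close> is the posterior with \<open>V = phi \<circ> q\<close>.\<close>

definition belief_value :: "('e \<Rightarrow> real) \<Rightarrow> bool" where
  "belief_value q \<longleftrightarrow> (\<forall>e. 0 \<le> q e \<and> q e \<le> 1) \<and> (\<forall>e e'. le e e' \<longrightarrow> q e \<le> q e') \<and>
    (\<forall>e. infsum (excess q) (q -` {q e}) = 0) \<and>
    (\<forall>e L. lower_contour le L (q -` {q e}) \<longrightarrow> 0 \<le> infsum (excess q) L)"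

section \<open>Posteriors and the sign of the excess\<close>

lemma g_nonneg: "0 \<le> g e"
  using p0_pos by (simp add: g_def)

lemma g_le_w: "g e \<le> w e"
  using p0_less by (simp add: g_def w_def)

lemma w_pos: "0 < w e"
  using full_support[rule_format, of e] p0_pos p0_less
  by (auto simp: w_def intro: add_pos_nonneg add_nonneg_pos)

lemma g_summable: "g summable_on A"
  using summable_on_cmult_left[OF pmf_summable_on] by (simp add: g_def[abs_def])

lemma w_summable: "w summable_on A"
  unfolding w_def[abs_def] by (intro summable_on_add summable_on_cmult_left pmf_summable_on)

lemma excess_summable:
  assumes "\<forall>e. 0 \<le> q e \<and> q e \<le> 1"
  shows "excess q summable_on A"
proof -
  have "\<bar>q e * w e\<bar> \<le> w e" for e
    using assms w_pos[of e] by (simp add: abs_mult mult_left_le_one_le)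
  then have "(\<lambda>e. q e * w e) summable_on A"
    by (intro summable_on_abs_le[OF w_summable])
  then show ?thesis
    unfolding excess_def[abs_def] by (intro summable_on_diff_real g_summable)
qed

lemma nu_eq: "nu FG FB p0 A = infsum g A / infsum w A"
proof -
  have "infsum g A = measure_pmf.prob FG A * p0"
    unfolding g_def[abs_def] by (simp add: infsum_cmult_left' infsum_pmf)
  moreover have "infsum w A = measure_pmf.prob FG A * p0 + measure_pmf.prob FB A * (1 - p0)"
    unfolding w_def[abs_def]
    by (simp add: infsum_add summable_on_cmult_left pmf_summable_on infsum_cmult_left' infsum_pmf)
  ultimately show ?thesis by (simp add: nu_def)
qed

lemma infsum_w_pos:
  assumes "A \<noteq> {}"
  shows "0 < infsum w A"
proof -
  obtain a where "a \<in> A" using assms by blast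
  then have "w a \<le> infsum w A"
    using finite_sum_le_infsum[OF w_summable[of A], of "{a}"] w_pos by (simp add: less_imp_le)
  then show ?thesis using w_pos[of a] by linarith
qed

lemma nu_bounds: "0 \<le> nu FG FB p0 A" "nu FG FB p0 A \<le> 1"
proof -
  have "0 \<le> infsum g A" by (intro infsum_nonneg g_nonneg)
  moreover have "infsum g A \<le> infsum w A" by (intro infsum_mono g_summable w_summable g_le_w)
  ultimately show "0 \<le> nu FG FB p0 A" "nu FG FB p0 A \<le> 1"
    by (auto simp: nu_eq divide_le_eq_1)
qed

lemma infsum_excess_const:
  assumes "A \<subseteq> q -` {c}"
  shows "infsum (excess q) A = infsum g A - c * infsum w A"
proof -
  have "infsum (excess q) A = infsum (\<lambda>e. g e - c * w e) A"
    using assms by (intro infsum_cong) (auto simp: excess_def)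
  also have "\<dots> = infsum g A - infsum (\<lambda>e. c * w e) A"
    by (intro infsum_diff_real g_summable summable_on_cmult_right w_summable)
  finally show ?thesis by (simp add: infsum_cmult_right')
qed

lemma excess_nonneg_iff:
  assumes "A \<noteq> {}" "A \<subseteq> q -` {c}"
  shows "0 \<le> infsum (excess q) A \<longleftrightarrow> c \<le> nu FG FB p0 A"
  using infsum_excess_const[OF assms(2)] infsum_w_pos[OF assms(1)]
  by (simp add: nu_eq pos_le_divide_eq)

lemma excess_zero_iff:
  assumes "A \<noteq> {}" "A \<subseteq> q -` {c}"
  shows "infsum (excess q) A = 0 \<longleftrightarrow> nu FG FB p0 A = c"
  using infsum_excess_const[OF assms(2)] infsum_w_pos[OF assms(1)]
  by (auto simp: nu_eq field_simps)

lemma excess_single_nonneg_iff: "0 \<le> excess q e \<longleftrightarrow> q e \<le> nu FG FB p0 {e}"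
  using excess_nonneg_iff[of "{e}" q "q e"] by simp

section \<open>Passing between values and posteriors\<close>

lemma phi_le_iff:
  assumes "0 \<le> x" "x \<le> 1" "0 \<le> y" "y \<le> 1"
  shows "phi x \<le> phi y \<longleftrightarrow> x \<le> y"
  using strict_mono_onD[OF phi_mono, of x y] strict_mono_onD[OF phi_mono, of y x] assms
  by (cases x y rule: linorder_cases) auto

lemma phi_eq_iff:
  assumes "0 \<le> x" "x \<le> 1" "0 \<le> y" "y \<le> 1"
  shows "phi x = phi y \<longleftrightarrow> x = y"
  using phi_le_iff[OF assms] phi_le_iff[OF assms(3,4,1,2)] by auto

lemma conditions_iff_belief_value:
  "conditions le FG FB p0 phi V \<longleftrightarrow> (\<exists>q. belief_value q \<and> V = phi \<circ> q)"
proof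
  assume "conditions le FG FB p0 phi V"
  then have V_mono: "\<And>e e'. le e e' \<Longrightarrow> V e \<le> V e'"
    and V_fibre: "\<And>e. phi (nu FG FB p0 (V -` {V e})) = V e"
    and V_lower: "\<And>e L. lower_contour le L (V -` {V e}) \<Longrightarrow> V e \<le> phi (nu FG FB p0 L)"
    by (auto simp: conditions_def xi_def)
  \<comment> \<open>Condition (2) makes this posterior a preimage of \<open>V e\<close> under
    \<open>phi\<close>; being constant on fibres of \<open>V\<close>, it has the same
    fibres.\<close>
  define q where "q e = nu FG FB p0 (V -` {V e})" for e
  have V: "V e = phi (q e)" for e by (simp add: q_def V_fibre)
  have q01: "\<forall>e. 0 \<le> q e \<and> q e \<le> 1" by (simp add: q_def nu_bounds)
  have fibre: "q -` {q e} = V -` {V e}" for e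
  proof -
    have "q x = q e \<longleftrightarrow> V x = V e" for x by (metis V q_def)
    then show ?thesis by auto
  qed
  have "q e \<le> q e'" if "le e e'" for e e'
    using V_mono[OF that] q01 by (simp add: V phi_le_iff)
  moreover have "infsum (excess q) (q -` {q e}) = 0" for e
  proof -
    have "q -` {q e} \<noteq> {}" by auto
    moreover have "nu FG FB p0 (q -` {q e}) = q e"
      unfolding fibre by (simp only: q_def)
    ultimately show ?thesis
      using excess_zero_iff[of "q -` {q e}" q "q e"] by simp
  qed
  moreover have "0 \<le> infsum (excess q) L" if "lower_contour le L (q -` {q e})" for e L
  proof -
    have L: "L \<noteq> {}" "L \<subseteq> q -` {q e}"
      using that by (auto simp: lower_contour_def)
    have "phi (q e) \<le> phi (nu FG FB p0 L)"
      using V_lower[of L e] that by (simp only: fibre flip: V)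
    then have "q e \<le> nu FG FB p0 L"
      using q01 phi_le_iff nu_bounds by blast
    then show ?thesis
      using excess_nonneg_iff[OF L] by simp
  qed
  ultimately have "belief_value q"
    using q01 by (auto simp: belief_value_def)
  then show "\<exists>q. belief_value q \<and> V = phi \<circ> q"
    using V by (intro exI[of _ q]) auto
next
  assume "\<exists>q. belief_value q \<and> V = phi \<circ> q"
  then obtain q where bv: "belief_value q" and V: "V = phi \<circ> q" by blast
  have q01: "\<forall>e. 0 \<le> q e \<and> q e \<le> 1" using bv by (simp add: belief_value_def)
  have fibre: "(phi \<circ> q) -` {phi (q e)} = q -` {q e}" for e
    using q01 phi_eq_iff by fastforce
  have "phi (nu FG FB p0 (q -` {q e})) = phi (q e)" for e
  proof -
    have "q -` {q e} \<noteq> {}" "infsum (excess q) (q -` {q e}) = 0"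
      using bv by (auto simp: belief_value_def)
    then show ?thesis
      using excess_zero_iff[of "q -` {q e}" q "q e"] by simp
  qed
  moreover have "phi (q e) \<le> phi (nu FG FB p0 L)" if "lower_contour le L (q -` {q e})" for e L
  proof -
    have L: "L \<noteq> {}" "L \<subseteq> q -` {q e}"
      using that by (auto simp: lower_contour_def)
    have "0 \<le> infsum (excess q) L"
      using bv that unfolding belief_value_def by blast
    then have "q e \<le> nu FG FB p0 L"
      using excess_nonneg_iff[OF L] by simp
    then show ?thesis using q01 by (simp add: phi_le_iff nu_bounds)
  qed
  moreover have "phi (q e) \<le> phi (q e')" if "le e e'" for e e'
    using bv that by (simp add: belief_value_def phi_le_iff)
  ultimately show "conditions le FG FB p0 phi V"
    by (auto simp: conditions_def xi_def V fibre)
qed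

section \<open>Uniqueness\<close>

text \<open>Each fibre meets \<open>L\<close> in the empty set or in a lower contour set of that
  fibre, so the fibre sums are nonnegative.\<close>

lemma belief_value_closed_nonneg:
  assumes "belief_value q" and "\<And>e m. e \<in> L \<Longrightarrow> le m e \<Longrightarrow> q m = q e \<Longrightarrow> m \<in> L"
  shows "0 \<le> infsum (excess q) L"
proof (rule infsum_fibres_nonneg)
  show "excess q summable_on L"
    using assms(1) by (intro excess_summable) (simp add: belief_value_def)
  show "0 \<le> infsum (excess q) (L \<inter> q -` {x})" for x
  proof (cases "L \<inter> q -` {x} = {}")
    case False
    then obtain e where "q e = x" by blast
    moreover from False have "lower_contour le (L \<inter> q -` {x}) (q -` {x})"
      using assms(2) by (auto simp: lower_contour_def)
    ultimately show ?thesis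
      using assms(1) by (auto simp: belief_value_def)
  qed simp
qed

text \<open>Within a fibre the complement of \<open>U\<close> is closed downwards and has
  nonnegative excess; the fibre total is zero, so the part in \<open>U\<close> is
  nonpositive.\<close>

lemma belief_value_upper_nonpos:
  assumes bv: "belief_value q" and up: "\<And>e m. m \<in> U \<Longrightarrow> le m e \<Longrightarrow> q m = q e \<Longrightarrow> e \<in> U"
  shows "infsum (excess q) U \<le> 0"
proof -
  have summ: "excess q summable_on A" for A
    using bv by (intro excess_summable) (simp add: belief_value_def)
  have "0 \<le> infsum (\<lambda>e. - excess q e) U"
  proof (rule infsum_fibres_nonneg)
    show "(\<lambda>e. - excess q e) summable_on U" by (simp add: summable_on_uminus summ)
    fix x
    show "0 \<le> infsum (\<lambda>e. - excess q e) (U \<inter> q -` {x})"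
    proof (cases "q -` {x} = {}")
      case False
      then obtain e where "q e = x" by blast
      then have "infsum (excess q) (q -` {x}) = 0"
        using bv by (auto simp: belief_value_def)
      moreover have "infsum (excess q) (U \<inter> q -` {x}) + infsum (excess q) (q -` {x} - U)
          = infsum (excess q) (q -` {x})"
        using infsum_Un_disjoint[OF summ summ, of "q -` {x} \<inter> U" "q -` {x} - U"]
        by (simp add: Int_Diff_Un Int_Diff_disjoint Int_commute[of U])
      moreover have "0 \<le> infsum (excess q) (q -` {x} - U)"
        using up by (intro belief_value_closed_nonneg[OF bv]) auto
      ultimately show ?thesis by (simp add: infsum_uminus)
    qed simp
  qed
  then show ?thesis by (simp add: infsum_uminus)
qed

lemma belief_value_le:
  assumes q: "belief_value q" and q': "belief_value q'"
  shows "q e \<le> q' e"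
proof (rule ccontr)
  assume e: "\<not> q e \<le> q' e"
  define D where "D = {e. q' e < q e}"
  have q01: "\<forall>e. 0 \<le> q e \<and> q e \<le> 1" "\<forall>e. 0 \<le> q' e \<and> q' e \<le> 1"
    and mono: "\<And>e e'. le e e' \<Longrightarrow> q e \<le> q e'" "\<And>e e'. le e e' \<Longrightarrow> q' e \<le> q' e'"
    using q q' by (auto simp: belief_value_def)
  \<comment> \<open>Within fibres of \<open>q\<close> the set \<open>D\<close> is lower, within fibres of \<open>q'\<close> it is upper.\<close>
  have "0 \<le> infsum (excess q) D"
    using mono(2) by (intro belief_value_closed_nonneg[OF q]) (auto simp: D_def intro: le_less_trans)
  moreover have "infsum (excess q') D \<le> 0"
    using mono(1) by (intro belief_value_upper_nonpos[OF q']) (auto simp: D_def intro: less_le_trans)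
  moreover have "infsum (excess q) D < infsum (excess q') D"
  proof (rule has_sum_strict_mono)
    show "(excess q has_sum infsum (excess q) D) D" "(excess q' has_sum infsum (excess q') D) D"
      using excess_summable q01 by auto
    show "excess q x \<le> excess q' x" if "x \<in> D" for x
      using that w_pos[of x] by (simp add: D_def excess_def)
    show "e \<in> D" using e by (simp add: D_def)
    show "excess q e < excess q' e"
      using e w_pos[of e] by (simp add: excess_def)
  qed
  ultimately show False by simp
qed

lemma belief_value_unique: "belief_value q \<Longrightarrow> belief_value q' \<Longrightarrow> q = q'"
  by (intro ext order_antisym belief_value_le)

section \<open>From equilibria to belief values\<close>

text \<open>All senders of \<open>m\<close> share the value \<open>c\<close>, so their weighted
  excess is the Bayes numerator minus \<open>c\<close> times the denominator. With
  \<open>0 < D\<close>, it vanishes exactly when the posterior is \<open>c\<close>; both directions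
  of the equivalence use this.\<close>

lemma bayes_identity:
  assumes senders: "\<forall>e. m \<in> set_pmf (\<sigma> e) \<longrightarrow> le m e \<and> q e = c"
  defines "N \<equiv> infsum (\<lambda>e. pmf (\<sigma> e) m * pmf FG e * p0) (UC le m)"
    and "D \<equiv> infsum (\<lambda>e. pmf (\<sigma> e) m * (pmf FG e * p0 + pmf FB e * (1 - p0))) (UC le m)"
  shows "infsum (\<lambda>e. pmf (\<sigma> e) m * excess q e) UNIV = N - c * D"
    and "\<And>e. m \<in> set_pmf (\<sigma> e) \<Longrightarrow> 0 < D"
proof -
  have outside: "pmf (\<sigma> e) m = 0" if "e \<notin> UC le m" for e
    using that senders by (auto simp: UC_def set_pmf_iff)
  have summ: "(\<lambda>e. pmf (\<sigma> e) m * h e) summable_on A" if "h summable_on A" "\<And>e. 0 \<le> h e" for h A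
    using that(2) by (intro summable_on_abs_le[OF that(1)]) (simp add: abs_mult pmf_le_1 mult_left_le_one_le)
  have gs: "(\<lambda>e. pmf (\<sigma> e) m * g e) summable_on A" for A
    by (intro summ g_summable g_nonneg)
  have ws: "(\<lambda>e. pmf (\<sigma> e) m * w e) summable_on A" for A
    by (intro summ w_summable less_imp_le w_pos)
  have N: "N = infsum (\<lambda>e. pmf (\<sigma> e) m * g e) (UC le m)"
    by (simp add: N_def g_def mult.assoc)
  have D: "D = infsum (\<lambda>e. pmf (\<sigma> e) m * w e) (UC le m)"
    by (simp add: D_def w_def)
  have "infsum (\<lambda>e. pmf (\<sigma> e) m * excess q e) UNIV
      = infsum (\<lambda>e. pmf (\<sigma> e) m * g e - c * (pmf (\<sigma> e) m * w e)) (UC le m)"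
  proof (rule infsum_cong_neutral)
    fix e assume "e \<in> UNIV \<inter> UC le m"
    show "pmf (\<sigma> e) m * excess q e = pmf (\<sigma> e) m * g e - c * (pmf (\<sigma> e) m * w e)"
    proof (cases "m \<in> set_pmf (\<sigma> e)")
      case True
      then show ?thesis using senders by (simp add: excess_def algebra_simps)
    qed (simp add: set_pmf_iff)
  qed (use outside in auto)
  also have "\<dots> = N - c * D"
    unfolding N D by (simp add: infsum_diff_real gs ws summable_on_cmult_right infsum_cmult_right')
  finally show "infsum (\<lambda>e. pmf (\<sigma> e) m * excess q e) UNIV = N - c * D" .
  show "0 < D" if "m \<in> set_pmf (\<sigma> e)" for e
  proof -
    have "0 < pmf (\<sigma> e) m * w e"
      using that w_pos by (simp add: pmf_positive)
    also have "\<dots> \<le> D"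
      using finite_sum_le_infsum[OF ws, of "{e}" "UC le m"] that senders w_pos
      by (simp add: D UC_def less_imp_le)
    finally show ?thesis .
  qed
qed

text \<open>By Bayes' rule the excess of the senders of each message, weighted by how often they send it,
cancels; so does its sum over a set \<open>L\<close> of messages.\<close>

lemma infsum_message_mass:
  assumes q01: "\<forall>e. 0 \<le> q e \<and> q e \<le> 1"
    and zero: "\<And>m. infsum (\<lambda>e. pmf (\<sigma> e) m * excess q e) UNIV = 0"
  shows "(\<lambda>e. measure_pmf.prob (\<sigma> e) L * excess q e) summable_on UNIV"
    and "infsum (\<lambda>e. measure_pmf.prob (\<sigma> e) L * excess q e) UNIV = 0"
proof -
  have abs: "(\<lambda>e. \<bar>excess q e\<bar>) summable_on UNIV"
    using excess_summable[OF q01] summable_on_iff_abs_summable_on_real[of "excess q" UNIV] by simp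
  show "(\<lambda>e. measure_pmf.prob (\<sigma> e) L * excess q e) summable_on UNIV"
    by (intro summable_on_abs_le[OF abs]) (simp add: abs_mult mult_left_le_one_le)
  \<comment> \<open>Exchanging the sums over types and messages needs summability on the product;
    the absolute row sums are dominated by the absolute excess.\<close>
  have "(\<lambda>z. norm ((\<lambda>(e, m). pmf (\<sigma> e) m * excess q e) z)) summable_on UNIV \<times> L"
  proof (subst Infinite_Sum.abs_summable_on_Sigma_iff, intro conjI ballI)
    fix e
    have "(\<lambda>m. pmf (\<sigma> e) m * excess q e) summable_on L"
      by (intro summable_on_cmult_left pmf_summable_on)
    then show "(\<lambda>m. norm (case (e, m) of (e, m) \<Rightarrow> pmf (\<sigma> e) m * excess q e)) summable_on L"
      using summable_on_iff_abs_summable_on_real by fastforce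
  next
    have "infsum (\<lambda>m. norm (case (e, m) of (e, m) \<Rightarrow> pmf (\<sigma> e) m * excess q e)) L
        = measure_pmf.prob (\<sigma> e) L * \<bar>excess q e\<bar>" for e
      by (simp add: abs_mult infsum_cmult_left' infsum_pmf)
    then show "(\<lambda>e. norm (infsum (\<lambda>m. norm (case (e, m) of (e, m) \<Rightarrow> pmf (\<sigma> e) m * excess q e)) L))
        summable_on UNIV"
      by (simp, intro summable_on_abs_le[OF abs]) (simp add: abs_mult mult_left_le_one_le)
  qed
  then have "(\<lambda>(e, m). pmf (\<sigma> e) m * excess q e) summable_on UNIV \<times> L"
    by (rule abs_summable_summable)
  from infsum_swap_banach[OF this]
  show "infsum (\<lambda>e. measure_pmf.prob (\<sigma> e) L * excess q e) UNIV = 0"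
    by (simp add: zero infsum_cmult_left' infsum_pmf)
qed

lemma equilibrium_imp_belief_value:
  assumes eq: "equilibrium le FG FB p0 phi \<sigma> a \<mu>" and val: "is_max_value le a V"
  shows "\<exists>q. belief_value q \<and> V = phi \<circ> q"
proof -
  from eq have mu01: "\<And>m. 0 \<le> \<mu> m \<and> \<mu> m \<le> 1"
    and best: "\<And>e m. m \<in> set_pmf (\<sigma> e) \<Longrightarrow> m \<in> argmax_LC le a e"
    and a: "\<And>m. a m = phi (\<mu> m)"
    and bayes: "\<And>m. on_path \<sigma> m \<Longrightarrow>
        \<mu> m = infsum (\<lambda>e. pmf (\<sigma> e) m * pmf FG e * p0) (UC le m) /
          infsum (\<lambda>e. pmf (\<sigma> e) m * (pmf FG e * p0 + pmf FB e * (1 - p0))) (UC le m)"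
    and truth: "\<And>e. e \<in> argmax_LC le a e \<Longrightarrow> pmf (\<sigma> e) e = 1"
    and off: "\<And>m. \<not> on_path \<sigma> m \<Longrightarrow> \<mu> m = nu FG FB p0 {m}"
    unfolding equilibrium_def by blast+
  have V_attained: "\<And>e. \<exists>m. le m e \<and> a m = V e" and V_upper: "\<And>e m. le m e \<Longrightarrow> a m \<le> V e"
    using val by (auto simp: is_max_value_def)
  have argmax: "m \<in> argmax_LC le a e \<longleftrightarrow> le m e \<and> a m = V e" for m e
  proof
    obtain m' where "le m' e" "a m' = V e" using V_attained by blast
    moreover assume "m \<in> argmax_LC le a e"
    ultimately show "le m e \<and> a m = V e"
      using V_upper[of m e] by (fastforce simp: argmax_LC_def)
  next
    assume "le m e \<and> a m = V e"
    then show "m \<in> argmax_LC le a e" using V_upper by (simp add: argmax_LC_def)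
  qed
  obtain b where b: "\<And>e. le (b e) e \<and> a (b e) = V e"
    using V_attained by metis
  \<comment> \<open>The choice of the maximiser \<open>b e\<close> is immaterial: \<open>phi\<close>
    is injective on beliefs, so all optimal messages carry the same one.\<close>
  define q where "q e = \<mu> (b e)" for e
  have q01: "\<forall>e. 0 \<le> q e \<and> q e \<le> 1" by (simp add: q_def mu01)
  have V: "V e = phi (q e)" for e
    using b a by (simp add: q_def)
  have q_le: "q e \<le> q e' \<longleftrightarrow> V e \<le> V e'" for e e'
    using q01 by (simp add: V phi_le_iff)
  have V_mono: "V e \<le> V e'" if "le e e'" for e e'
    using b[of e] V_upper[of "b e" e'] that le_trans by (metis transpD)
  have mu_q: "\<mu> m = q e" if "a m = V e" for m e
    using that mu01[of m] q01 by (simp add: a V phi_eq_iff)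
  \<comment> \<open>\<open>V m\<close> is at most \<open>V e\<close> by monotonicity and at least
    \<open>a m = V e\<close>, since \<open>m\<close> can disclose itself. Messages therefore stay in
    the sender's fibre.\<close>
  have sent: "le m e \<and> a m = V e \<and> V m = V e" if "m \<in> set_pmf (\<sigma> e)" for m e
  proof -
    have "le m e" "a m = V e" using best[OF that] by (auto simp: argmax)
    then show ?thesis
      using V_mono V_upper[of m m] le_refl by (force dest: reflpD)
  qed
  have zero: "infsum (\<lambda>e. pmf (\<sigma> e) m * excess q e) UNIV = 0" for m
  proof (cases "on_path \<sigma> m")
    case True
    then obtain e where e: "m \<in> set_pmf (\<sigma> e)" by (auto simp: on_path_def)
    have senders: "\<forall>e. m \<in> set_pmf (\<sigma> e) \<longrightarrow> le m e \<and> q e = \<mu> m"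
      using sent mu_q by metis
    show ?thesis
      using bayes_identity[OF senders] bayes[OF True] e by fastforce
  next
    case False
    then show ?thesis by (simp add: on_path_def set_pmf_iff)
  qed
  \<comment> \<open>Types that do not disclose are off path, so their own posterior lies below that of their pool.\<close>
  have silent: "excess q e < 0" if "a e \<noteq> V e" for e
  proof -
    have "a e < V e" using that V_upper[of e e] le_refl by (simp add: reflpD order_less_le)
    moreover have "\<not> on_path \<sigma> e"
    proof
      assume "on_path \<sigma> e"
      then obtain e' where "e \<in> set_pmf (\<sigma> e')" by (auto simp: on_path_def)
      then show False using sent[of e e'] that by simp
    qed
    ultimately have "\<not> q e \<le> nu FG FB p0 {e}"
      using q01 mu01[of e] off[of e] phi_le_iff[of "q e" "\<mu> e"] by (simp add: a V)
    then show ?thesis using excess_single_nonneg_iff[of q e] by simp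
  qed
  have truthful: "measure_pmf.prob (\<sigma> e) L = 0" if "a e = V e" "e \<notin> L" for e L
  proof -
    have "measure_pmf.prob (\<sigma> e) {e} = 1"
      using truth[of e] that(1) le_refl by (simp add: argmax reflpD measure_pmf_single)
    then have "measure_pmf.prob (\<sigma> e) (- {e}) = 0"
      using measure_pmf.prob_compl[of "{e}" "\<sigma> e"] by (simp add: Compl_eq_Diff_UNIV)
    moreover have "measure_pmf.prob (\<sigma> e) L \<le> measure_pmf.prob (\<sigma> e) (- {e})"
      using that(2) by (intro measure_pmf.finite_measure_mono) auto
    ultimately show ?thesis using measure_nonneg[of "\<sigma> e" L] by simp
  qed
  have inside: "measure_pmf.prob (\<sigma> e) L = 1" if "lower_contour le L (q -` {x})" "e \<in> L" for e L x
  proof -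
    have "m \<in> L" if "m \<in> set_pmf (\<sigma> e)" for m
    proof -
      have "le m e" "q m = q e"
        using sent[OF that] q_le[of m e] q_le[of e m] by simp_all
      then show ?thesis
        using \<open>lower_contour le L (q -` {x})\<close> \<open>e \<in> L\<close> by (auto simp: lower_contour_def)
    qed
    then show ?thesis by (simp add: measure_pmf.prob_eq_1 AE_measure_pmf_iff)
  qed
  have lower: "0 \<le> infsum (excess q) L" if L: "lower_contour le L (q -` {x})" for L x
  proof -
    \<comment> \<open>Weights are one on \<open>L\<close>. Outside \<open>L\<close>, a disclosing
      type has weight zero and any other type has negative excess.\<close>
    have "infsum (\<lambda>e. measure_pmf.prob (\<sigma> e) L * excess q e) UNIV \<le> infsum (excess q) L"
    proof (intro infsum_mono_neutral infsum_message_mass(1) excess_summable q01 zero)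
      show "measure_pmf.prob (\<sigma> e) L * excess q e \<le> excess q e" if "e \<in> UNIV \<inter> L" for e
        using that inside[OF L] by simp
      show "measure_pmf.prob (\<sigma> e) L * excess q e \<le> 0" if "e \<in> UNIV - L" for e
        using that truthful[of e L] silent[of e]
        by (cases "a e = V e") (auto intro: mult_nonneg_nonpos)
    qed auto
    then show ?thesis by (simp add: infsum_message_mass(2) q01 zero)
  qed
  have fibre: "infsum (excess q) (q -` {q e}) = 0" for e
  proof -
    let ?F = "q -` {q e}"
    have F: "lower_contour le ?F ?F" by (auto simp: lower_contour_def)
    have "measure_pmf.prob (\<sigma> e') ?F = 0" if "e' \<notin> ?F" for e'
    proof -
      have "q m = q e'" if "m \<in> set_pmf (\<sigma> e')" for m
        using sent[OF that] q_le[of m e'] q_le[of e' m] by simp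
      then show ?thesis
        using that by (auto simp: measure_pmf.prob_eq_0 AE_measure_pmf_iff)
    qed
    then have "infsum (\<lambda>e. measure_pmf.prob (\<sigma> e) ?F * excess q e) UNIV = infsum (excess q) ?F"
      using inside[OF F] by (intro infsum_cong_neutral) auto
    then show ?thesis using infsum_message_mass(2)[OF q01 zero] by simp
  qed
  have "belief_value q"
    using q01 q_le V_mono lower fibre by (auto simp: belief_value_def)
  then show ?thesis using V by (intro exI[of _ q]) auto
qed

section \<open>From belief values to equilibria\<close>

lemma belief_value_imp_equilibrium:
  assumes bv: "belief_value q"
  shows "\<exists>\<sigma> a \<mu>. equilibrium le FG FB p0 phi \<sigma> a \<mu> \<and> is_max_value le a (phi \<circ> q)"
proof -
  let ?f = "excess q"
  have q01: "\<forall>e. 0 \<le> q e \<and> q e \<le> 1" and q_mono: "\<And>e e'. le e e' \<Longrightarrow> q e \<le> q e'"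
    using bv by (auto simp: belief_value_def)
  have refl: "le e e" for e using le_refl by (simp add: reflpD)
  define R where "R e m \<longleftrightarrow> le m e \<and> q m = q e" for e m
  define d where "d e = max 0 (- ?f e)" for e
  define s where "s e = max 0 (?f e)" for e
  have d0: "0 \<le> d e" and s0: "0 \<le> s e" for e by (simp_all add: d_def s_def)
  have f: "?f e = s e - d e" for e by (simp add: d_def s_def)
  have abs: "(\<lambda>e. \<bar>?f e\<bar>) summable_on A" for A
    using excess_summable[OF q01] summable_on_iff_abs_summable_on_real[of "?f" A] by simp
  have ds: "d summable_on A" "s summable_on A" for A
    by (intro summable_on_abs_le[OF abs]; simp add: d_def s_def)+
  have f_sum: "infsum ?f A = infsum s A - infsum d A" for A
    using infsum_diff_real[OF ds(2) ds(1)] ext[of ?f, OF f] by simp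
  have "infsum ?f UNIV = 0"
    using belief_value_closed_nonneg[OF bv, of UNIV] belief_value_upper_nonpos[OF bv, of UNIV] by simp
  then have total: "infsum d UNIV = infsum s UNIV" by (simp add: f_sum)
  \<comment> \<open>\<open>?N\<close> contains \<open>S\<close> by reflexivity and is closed
    downwards within fibres by transitivity, so its deficits, and hence those of \<open>S\<close>,
    are covered by its surpluses.\<close>
  have hall: "infsum d S \<le> infsum s {m. \<exists>e\<in>S. R e m}" for S
  proof -
    let ?N = "{m. \<exists>e\<in>S. R e m}"
    have "infsum d S \<le> infsum d ?N"
      using refl by (intro infsum_mono2 ds) (auto simp: R_def d_def)
    moreover have "0 \<le> infsum ?f ?N"
      using le_trans by (intro belief_value_closed_nonneg[OF bv]) (auto simp: R_def dest: transpD)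
    ultimately show ?thesis by (simp add: f_sum)
  qed
  obtain \<kappa> where \<kappa>: "\<And>e m. 0 < d e \<Longrightarrow> m \<in> set_pmf (\<kappa> e) \<Longrightarrow> R e m \<and> 0 < s m"
    and inflow: "\<And>m. infsum (\<lambda>e. d e * pmf (\<kappa> e) m) UNIV = s m"
    using transport_kernel[of d s R, OF d0 ds(1) s0 ds(2) total hall] by blast
  \<comment> \<open>Types with zero excess must disclose too: their own posterior equals
    \<open>q e\<close>, so disclosure is optimal and truth-leaning requires it.\<close>
  define \<sigma> where "\<sigma> e = (if 0 \<le> ?f e then return_pmf e else \<kappa> e)" for e
  define \<mu> where "\<mu> m = (if 0 \<le> ?f m then q m else nu FG FB p0 {m})" for m
  define a where "a m = phi (\<mu> m)" for m
  have sent: "le m e \<and> q m = q e \<and> 0 \<le> ?f m" if "m \<in> set_pmf (\<sigma> e)" for m e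
  proof (cases "0 \<le> ?f e")
    case True
    then show ?thesis using that refl by (simp add: \<sigma>_def)
  next
    case False
    then have "R e m \<and> 0 < s m"
      using \<kappa>[of e m] that by (simp add: \<sigma>_def d_def)
    then show ?thesis by (auto simp: R_def s_def)
  qed
  have on_path: "on_path \<sigma> m \<longleftrightarrow> 0 \<le> ?f m" for m
  proof
    assume "on_path \<sigma> m"
    then show "0 \<le> ?f m" using sent by (auto simp: on_path_def)
  next
    assume "0 \<le> ?f m"
    then have "m \<in> set_pmf (\<sigma> m)" by (simp add: \<sigma>_def)
    then show "on_path \<sigma> m" unfolding on_path_def by blast
  qed
  have mu01: "0 \<le> \<mu> m \<and> \<mu> m \<le> 1" for m
    using q01 by (simp add: \<mu>_def nu_bounds)
  \<comment> \<open>Negative excess means that the type's own posterior lies strictly below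
    \<open>q m\<close>, so the off-path belief makes disclosure strictly worse than pooling.\<close>
  have a_le: "a m \<le> phi (q m)" for m
    using excess_single_nonneg_iff[of q m] mu01[of m] q01 by (simp add: a_def phi_le_iff \<mu>_def)
  have a_eq: "a m = phi (q m) \<longleftrightarrow> 0 \<le> ?f m" for m
    using excess_single_nonneg_iff[of q m] mu01[of m] q01 by (auto simp: a_def phi_eq_iff \<mu>_def)
  have upper: "a m \<le> phi (q e)" if "le m e" for m e
    using a_le[of m] q_mono[OF that] q01 phi_le_iff[of "q m" "q e"] by simp
  have sent_value: "le m e \<and> a m = phi (q e)" if "m \<in> set_pmf (\<sigma> e)" for m e
    using sent[OF that] a_eq[of m] by simp
  have attained: "\<exists>m. le m e \<and> a m = phi (q e)" for e
    using sent_value[of _ e] set_pmf_not_empty[of "\<sigma> e"] by blast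
  have bayes: "\<mu> m = infsum (\<lambda>e. pmf (\<sigma> e) m * pmf FG e * p0) (UC le m) /
      infsum (\<lambda>e. pmf (\<sigma> e) m * (pmf FG e * p0 + pmf FB e * (1 - p0))) (UC le m)"
    if "on_path \<sigma> m" for m
  proof -
    have m: "0 \<le> ?f m" using that on_path by simp
    have senders: "\<forall>e. m \<in> set_pmf (\<sigma> e) \<longrightarrow> le m e \<and> q e = q m"
      using sent by metis
    have flow: "(\<lambda>e. d e * pmf (\<kappa> e) m) summable_on UNIV"
      by (intro summable_on_abs_le[OF ds(1)]) (simp add: d_def abs_mult mult_left_le pmf_le_1)
    have single: "(\<lambda>e. if e = m then ?f m else 0) summable_on UNIV"
        "infsum (\<lambda>e. if e = m then ?f m else 0) UNIV = ?f m"
      using has_sum_finite_neutralI[of "{m}" UNIV "\<lambda>e. if e = m then ?f m else 0"]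
      by (auto simp: summable_on_def intro!: infsumI)
    \<comment> \<open>Type \<open>m\<close> contributes its surplus and the concealing types remove
      their share of deficit. By \<open>inflow\<close> the shares add up to that surplus.\<close>
    have "pmf (\<sigma> e) m * ?f e = (if e = m then ?f m else 0) - d e * pmf (\<kappa> e) m" for e
      using m by (auto simp: \<sigma>_def d_def)
    then have "infsum (\<lambda>e. pmf (\<sigma> e) m * ?f e) UNIV = ?f m - s m"
      by (simp add: infsum_diff_real single flow inflow)
    moreover have "m \<in> set_pmf (\<sigma> m)" using m by (simp add: \<sigma>_def)
    note bayes_identity(2)[OF senders this]
    ultimately show ?thesis
      using bayes_identity(1)[OF senders] m by (simp add: \<mu>_def s_def eq_divide_eq)
  qed
  have argmax: "m \<in> argmax_LC le a e \<longleftrightarrow> le m e \<and> a m = phi (q e)" for m e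
  proof
    assume "m \<in> argmax_LC le a e"
    then show "le m e \<and> a m = phi (q e)"
      using attained[of e] upper[of m e] by (fastforce simp: argmax_LC_def)
  next
    assume "le m e \<and> a m = phi (q e)"
    then show "m \<in> argmax_LC le a e" using upper by (simp add: argmax_LC_def)
  qed
  have "equilibrium le FG FB p0 phi \<sigma> a \<mu>"
    unfolding equilibrium_def
  proof (intro conjI allI impI)
    show "set_pmf (\<sigma> e) \<subseteq> LC le e" for e using sent_value by (auto simp: LC_def)
    show "set_pmf (\<sigma> e) \<subseteq> argmax_LC le a e" for e using sent_value by (auto simp: argmax)
    show "0 \<le> \<mu> m" "\<mu> m \<le> 1" for m using mu01 by auto
    show "a m = phi (\<mu> m)" for m by (rule a_def)
    show "pmf (\<sigma> e) e = 1" if "e \<in> argmax_LC le a e" for e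
      using that a_eq[of e] by (simp add: argmax \<sigma>_def)
    show "\<mu> m = nu FG FB p0 {m}" if "\<not> on_path \<sigma> m" for m
      using that by (simp add: on_path \<mu>_def)
  qed (rule bayes)
  moreover have "is_max_value le a (phi \<circ> q)"
    using attained upper by (simp add: is_max_value_def)
  ultimately show ?thesis by blast
qed

end

theorem theorem1:
  fixes le :: "'e::countable \<Rightarrow> 'e \<Rightarrow> bool"
    and FG FB :: "'e pmf"
    and p0 :: real
    and uR :: "real \<Rightarrow> state \<Rightarrow> real"
    and phi :: "real \<Rightarrow> real"
  assumes "0 < p0" and "p0 < 1"
    and "\<forall>e. pmf FG e > 0 \<or> pmf FB e > 0"
    and "disclosure_rule le"
    and "\<forall>\<mu>\<in>{0..1}. \<forall>a. a \<noteq> phi \<mu> \<longrightarrow>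
           \<mu> * uR a G + (1 - \<mu>) * uR a B < \<mu> * uR (phi \<mu>) G + (1 - \<mu>) * uR (phi \<mu>) B"
    and "strict_mono_on {0..1} phi"
  shows "(\<forall>V. equilibrium_value le FG FB p0 phi V \<longleftrightarrow> conditions le FG FB p0 phi V) \<and>
         (\<forall>V V'. conditions le FG FB p0 phi V \<longrightarrow> conditions le FG FB p0 phi V' \<longrightarrow> V = V')"
proof -
  interpret evidence_game le FG FB p0 phi
    using assms by unfold_locales (auto simp: disclosure_rule_def)
  have "equilibrium_value le FG FB p0 phi V \<longleftrightarrow> conditions le FG FB p0 phi V" for V
    unfolding equilibrium_value_def conditions_iff_belief_value
    using equilibrium_imp_belief_value belief_value_imp_equilibrium by blast
  then show ?thesis
    using belief_value_unique by (auto simp: conditions_iff_belief_value)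
qed

end
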